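(* Let $n$ and $k$ be positive integers, let $L=\operatorname{lcm}(2,k)$, and let $\mathcal A(n)$ be a family of partitions of $n$ of type $\mathcal P$. For $r=0,1,\dots,L-1$, let $M_r(n)$ denote the total number of parts congruent to $r\pmod L$ occurring in all objects of $\mathcal A(n)$, counted with multiplicity. Then $$ S_{\mathcal P}(n)\equiv 0\pmod k \quad\text{if and only if}\quad \sum_{r=0}^{L-1}(-1)^{r+1}\,r\,M_r(n)\equiv 0\pmod k. $$
   Context: A "type" $\mathcal P$ of partitions is an arbitrary class of partitions (for example ordinary partitions, partitions into distinct parts, overpartitions, coloured partitions); each partition $\lambda$ of $n$ of type $\mathcal P$ has a finite multiset of positive integer parts with sum $n$. $\mathcal A(n)$ is a finite family of partitions of $n$ of type $\mathcal P$. For $\lambda\in\mathcal A(n)$, $\omega(\lambda)$ is the sum of the odd parts of $\lambda$ minus the sum of the even parts of $\lambda$ (with multiplicity), and $S_{\mathcal P}(n)=\sum_{\lambda\in\mathcal A(n)}\omega(\lambda)$. *)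

theory Defs
  imports Complex_Main "HOL-Library.Multiset" "HOL-Number_Theory.Cong"
begin

text \<open>
  A type of partitions is a class \<open>P\<close> of objects of an arbitrary Isabelle type, together with a
  map \<open>parts\<close> giving the finite multiset of positive parts of each object. The objects need not be
  determined by their parts (consider overpartitions or coloured partitions).
\<close>

definition partition_type :: "'a set \<Rightarrow> ('a \<Rightarrow> nat multiset) \<Rightarrow> bool" where
  "partition_type P parts \<longleftrightarrow> (\<forall>x\<in>P. \<forall>p\<in>#parts x. p > 0)"

definition partitions_of :: "'a set \<Rightarrow> ('a \<Rightarrow> nat multiset) \<Rightarrow> nat \<Rightarrow> 'a set" where
  "partitions_of P parts n = {x \<in> P. sum_mset (parts x) = n}"

definition omega :: "('a \<Rightarrow> nat multiset) \<Rightarrow> 'a \<Rightarrow> int" where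
  "omega parts x =
     (\<Sum>p\<in>#filter_mset odd (parts x). int p) - (\<Sum>p\<in>#filter_mset even (parts x). int p)"

definition omega_sum :: "('a \<Rightarrow> nat multiset) \<Rightarrow> 'a set \<Rightarrow> int" where
  "omega_sum parts F = (\<Sum>x\<in>F. omega parts x)"

definition residue_parts :: "('a \<Rightarrow> nat multiset) \<Rightarrow> 'a set \<Rightarrow> nat \<Rightarrow> nat \<Rightarrow> nat" where
  "residue_parts parts F L r = (\<Sum>x\<in>F. size {#p \<in># parts x. [p = r] (mod L)#})"

end

theory Submission
  imports Defs
begin

text \<open>
  The weight of a part \<open>p\<close> in \<open>\<omega>\<close> is \<open>(-1) ^ (p + 1) * p\<close>. Modulo \<open>k\<close> it depends only on
  \<open>p mod L\<close>: the sign because \<open>2\<close> divides \<open>L\<close>, the factor \<open>p\<close> because \<open>k\<close> divides \<open>L\<close>.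
  Grouping the parts by their residue modulo \<open>L\<close> shows that the two sums are congruent.
\<close>

lemma omega_eq_signed_sum: "omega parts x = (\<Sum>p\<in>#parts x. (-1) ^ (p + 1) * int p)"
proof -
  have "(\<Sum>p\<in>#filter_mset odd M. int p) - (\<Sum>p\<in>#filter_mset even M. int p) =
      (\<Sum>p\<in>#M. (-1) ^ (p + 1) * int p)" for M
    \<comment> \<open>Each part survives exactly one of the two filters, and the exponent
      \<open>p + 1\<close> is even exactly when \<open>p\<close> is odd.\<close>
    by (induction M) auto
  then show ?thesis
    by (simp add: omega_def)
qed

text \<open>Each part \<open>p\<close> is counted in exactly one class below \<open>L\<close>, that
  of \<open>r = p mod L\<close>, so adding \<open>p\<close> to \<open>M\<close> raises the left side
  by \<open>f (p mod L)\<close>.\<close>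

lemma sum_residue_classes_mset:
  fixes f :: "nat \<Rightarrow> int"
  assumes "L > 0"
  shows "(\<Sum>r<L. f r * int (size {#p \<in># M. [p = r] (mod L)#})) = (\<Sum>p\<in>#M. f (p mod L))"
proof (induction M)
  case (add p M)
  have "f r * int (size {#q \<in># add_mset p M. [q = r] (mod L)#}) =
      f r * int (size {#q \<in># M. [q = r] (mod L)#}) + (if r = p mod L then f r else 0)"
    if "r < L" for r
    using that by (auto simp: cong_def algebra_simps)
  then show ?case
    using assms by (simp add: sum.distrib add.IH add.commute)
qed simp

lemma cong_sum_mset:
  fixes f g :: "'b \<Rightarrow> int"
  assumes "\<And>p. p \<in># M \<Longrightarrow> [f p = g p] (mod m)"
  shows "[(\<Sum>p\<in>#M. f p) = (\<Sum>p\<in>#M. g p)] (mod m)"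
  using assms by (induction M) (auto intro: cong_add)

lemma cong_signed_part:
  assumes "even L" and "k dvd L"
  shows "[(-1) ^ (p + 1) * int p = (-1) ^ (p mod L + 1) * int (p mod L)] (mod int k)"
proof -
  have "even (p mod L) \<longleftrightarrow> even p"
    using assms(1) by (simp add: dvd_mod_iff)
  then have "(-1 :: int) ^ (p mod L + 1) = (-1) ^ (p + 1)"
    by (simp add: minus_one_power_iff)
  moreover have "[int p = int (p mod L)] (mod int k)"
    unfolding cong_int_iff using assms(2) by (simp add: cong_def mod_mod_cancel)
  ultimately show ?thesis
    by (simp only: cong_scalar_left)
qed

lemma omega_sum_cong_residue_parts:
  assumes "L > 0" and "even L" and "k dvd L"
  shows "[omega_sum parts F =
    (\<Sum>r<L. (-1) ^ (r + 1) * int r * int (residue_parts parts F L r))] (mod int k)"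
proof -
  have "(\<Sum>r<L. (-1) ^ (r + 1) * int r * int (residue_parts parts F L r)) =
      (\<Sum>x\<in>F. \<Sum>r<L. (-1) ^ (r + 1) * int r * int (size {#p \<in># parts x. [p = r] (mod L)#}))"
    \<comment> \<open>With the sum over objects outermost, the regrouping by residues applies to one
      multiset at a time.\<close>
    unfolding residue_parts_def of_nat_sum sum_distrib_left by (rule sum.swap)
  also have "\<dots> = (\<Sum>x\<in>F. \<Sum>p\<in>#parts x. (-1) ^ (p mod L + 1) * int (p mod L))"
    by (intro sum.cong refl sum_residue_classes_mset assms(1))
  also have "[omega_sum parts F = \<dots>] (mod int k)"
    unfolding omega_sum_def omega_eq_signed_sum
    by (intro cong_sum cong_sum_mset cong_signed_part assms(2,3))
  finally show ?thesis .
qed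

theorem theorem4p4:
  fixes P :: "'a set" and parts :: "'a \<Rightarrow> nat multiset"
    and A :: "nat \<Rightarrow> 'a set" and n k L :: nat
  assumes "n > 0" and "k > 0"
    and "L = lcm 2 k"
    and "partition_type P parts"
    and "finite (A n)" and "A n \<subseteq> partitions_of P parts n"
  shows "[omega_sum parts (A n) = 0] (mod int k) \<longleftrightarrow>
    [(\<Sum>r = 0..L - 1. (-1) ^ (r + 1) * int r * int (residue_parts parts (A n) L r)) = 0] (mod int k)"
proof -
  have L: "L > 0" "even L" "k dvd L"
    using assms(2,3) by (auto simp: lcm_pos_nat)
  \<comment> \<open>The subtraction in \<open>L - 1\<close> is truncated, so \<open>L > 0\<close>
    matters here.\<close>
  then have "{0..L - 1} = {..<L}"
    by auto
  then show ?thesis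
    using omega_sum_cong_residue_parts[OF L, of parts "A n"] by (simp only: cong_def)
qed

end
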